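(* Let $n \geq 1$, let $\pi$ be a power function for $n$ players, and let $S \subset A$ be a stable set (with respect to $\pi$). Then $$|S| \leq 3^{2^n-1}.$$
   Context: Notation: $[n] = \{1,\ldots,n\}$ is the set of players, $\mathcal{P}[n]$ its power set, and the set of allocations is $$A = \{x \in \mathbb{R}^n : x_i \geq 0 \text{ for all } i \in [n] \text{ and } \sum_{i=1}^n x_i = 1\}.$$ A power function is a map $\pi : \mathcal{P}[n] \times A \to \mathbb{R}$ satisfying, for all $C, C' \subset [n]$ and $x, x' \in A$: (p.1) if $C \subset C'$ then $\pi(C',x) \geq \pi(C,x)$; (p.2) if $x'_i \geq x_i$ for all $i \in C$ then $\pi(C,x') \geq \pi(C,x)$; (p.3) if $C \neq \emptyset$ and $x'_i > x_i$ for all $i \in C$ then $\pi(C,x') > \pi(C,x)$. For $x, x' \in A$ let $W = \{i : x'_i > x_i\}$ and $L = \{i : x'_i < x_i\}$. Then $x'$ dominates $x$ if $\pi(W,x) > \pi(L,x)$. A set $S \subset A$ is a stable set if (internal stability) no element of $S$ is dominated by any other element of $S$, and (external stability) each element of $A \setminus S$ is dominated by some element of $S$. *)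

theory Defs
  imports "HOL-Analysis.Analysis"
begin

text \<open>
  The players are the elements of a finite type \<open>'n\<close>, so the number of players is
  \<open>CARD('n) \<ge> 1\<close>, coalitions have type \<open>'n set\<close>, and allocations live in \<open>real ^ 'n\<close>.
\<close>

definition allocations :: "(real ^ 'n) set" where
  "allocations = {x. (\<forall>i. 0 \<le> x $ i) \<and> (\<Sum>i\<in>UNIV. x $ i) = 1}"

text \<open>
  A power function is defined on allocations only; its values outside \<open>allocations\<close> are
  unconstrained and are never used.
\<close>

definition power_function :: "('n set \<Rightarrow> real ^ 'n \<Rightarrow> real) \<Rightarrow> bool" where
  "power_function \<pi> \<longleftrightarrow>
     (\<forall>C C'. \<forall>x\<in>allocations. C \<subseteq> C' \<longrightarrow> \<pi> C' x \<ge> \<pi> C x) \<and>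
     (\<forall>C. \<forall>x\<in>allocations. \<forall>x'\<in>allocations.
        (\<forall>i\<in>C. x' $ i \<ge> x $ i) \<longrightarrow> \<pi> C x' \<ge> \<pi> C x) \<and>
     (\<forall>C. \<forall>x\<in>allocations. \<forall>x'\<in>allocations.
        C \<noteq> {} \<and> (\<forall>i\<in>C. x' $ i > x $ i) \<longrightarrow> \<pi> C x' > \<pi> C x)"

text \<open>\<open>dominates \<pi> x' x\<close>: the power comparison is made at the dominated allocation \<open>x\<close>.\<close>

definition dominates :: "('n set \<Rightarrow> real ^ 'n \<Rightarrow> real) \<Rightarrow> real ^ 'n \<Rightarrow> real ^ 'n \<Rightarrow> bool" where
  "dominates \<pi> x' x \<longleftrightarrow> \<pi> {i. x' $ i > x $ i} x > \<pi> {i. x' $ i < x $ i} x"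

definition stable_set :: "('n set \<Rightarrow> real ^ 'n \<Rightarrow> real) \<Rightarrow> (real ^ 'n) set \<Rightarrow> bool" where
  "stable_set \<pi> S \<longleftrightarrow>
     S \<subseteq> allocations \<and>
     (\<forall>x\<in>S. \<forall>y\<in>S. y \<noteq> x \<longrightarrow> \<not> dominates \<pi> y x) \<and>
     (\<forall>x\<in>allocations - S. \<exists>y\<in>S. dominates \<pi> y x)"

end

theory Submission
  imports Defs
begin

text \<open>
  Compare two points \<open>x\<close>, \<open>y\<close> by the set \<open>U\<close> of coordinates
  that rise and the set \<open>D\<close> of coordinates that fall from \<open>x\<close> to \<open>y\<close>. A stable set contains no
  four points \<open>a\<close>, \<open>b\<close>, \<open>c\<close>, \<open>d\<close> with the same pair \<open>(U, D) \<noteq> ({}, {})\<close> between successive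
  points: \<open>a\<close> does not dominate \<open>b\<close>, so \<open>D\<close> is at most as powerful as \<open>U\<close> at \<open>b\<close>; \<open>d\<close> does not
  dominate \<open>c\<close>, so \<open>U\<close> is at most as powerful as \<open>D\<close> at \<open>c\<close>; but from \<open>b\<close> to \<open>c\<close> the power of
  \<open>U\<close> grows and that of \<open>D\<close> shrinks, one of them strictly
  (\<open>stable_set_imp_monotone_chains_le_3\<close>).

  The rest is a theorem of Erdos--Szekeres type, with ties between coordinates allowed: a set of
  points that vary in \<open>m\<close> coordinates only, and whose chains of constant type \<open>(U, D)\<close> have at most
  \<open>l \<ge> 3\<close> points, has at most \<open>l ^ (2 ^ m - 1)\<close> points (\<open>card_le_if_monotone_chains_le\<close>). Up to
  reversal there are \<open>2 ^ (m - 1)\<close> types in which every coordinate changes. The heights of a point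
  in these \<open>2 ^ (m - 1)\<close> partial orders sort the points into \<open>l ^ (2 ^ (m - 1))\<close> classes, and any
  two points of a class share one of the \<open>m\<close> coordinates. It remains to see, by induction on \<open>m\<close>,
  that a class \<open>T\<close> has at most \<open>l ^ (2 ^ (m - 1) - 1)\<close> points. If all of \<open>T\<close> agree in one
  coordinate, this is the bound for \<open>m - 1\<close>. Otherwise fix \<open>x \<in> T\<close> and, for each coordinate \<open>i\<close>,
  a point \<open>y i \<in> T\<close> that differs from \<open>x\<close> in \<open>i\<close>. A point of \<open>T\<close> agrees with \<open>x\<close> in some \<open>i\<close> and
  then with \<open>y i\<close> in some \<open>j \<noteq> i\<close>, so \<open>T\<close> is covered by \<open>m (m - 1)\<close> sets in which two coordinates
  are fixed. The bound for \<open>m - 2\<close> is so much smaller that it absorbs the factor \<open>m (m - 1)\<close>; this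
  is where \<open>l \<ge> 3\<close> is used.
\<close>

section \<open>Chains of constant type\<close>

definition moves :: "'a set \<Rightarrow> 'a set \<Rightarrow> ('a \<Rightarrow> 'b::linorder) \<Rightarrow> ('a \<Rightarrow> 'b) \<Rightarrow> bool" where
  "moves U D x y \<longleftrightarrow> {i. x i < y i} = U \<and> {i. y i < x i} = D"

text \<open>
  The type \<open>({}, {})\<close> is excluded because its chains repeat one point and can be arbitrarily long.
  All other types force the points of a chain to be distinct.
\<close>

definition monotone_chains_le :: "nat \<Rightarrow> ('a \<Rightarrow> 'b::linorder) set \<Rightarrow> bool" where
  "monotone_chains_le l S \<longleftrightarrow>
     (\<forall>U D xs. U \<union> D \<noteq> {} \<and> set xs \<subseteq> S \<and> sorted_wrt (moves U D) xs \<longrightarrow> length xs \<le> l)"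

lemma monotone_chains_le_subset:
  "monotone_chains_le l S \<Longrightarrow> T \<subseteq> S \<Longrightarrow> monotone_chains_le l T"
  unfolding monotone_chains_le_def by (meson subset_trans)

lemma transp_moves: "transp (moves U D)"
proof (rule transpI)
  fix x y z :: "'a \<Rightarrow> 'b"
  assume "moves U D x y" "moves U D y z"
  then have xy: "x i < y i \<longleftrightarrow> i \<in> U" "y i < x i \<longleftrightarrow> i \<in> D"
    and yz: "y i < z i \<longleftrightarrow> i \<in> U" "z i < y i \<longleftrightarrow> i \<in> D" for i
    unfolding moves_def by auto
  have "(x i < z i \<longleftrightarrow> i \<in> U) \<and> (z i < x i \<longleftrightarrow> i \<in> D)" for i
    using xy[of i] yz[of i] by (metis less_asym less_trans linorder_neqE)
  then show "moves U D x z"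
    unfolding moves_def by auto
qed

text \<open>
  The function is the height: the greatest length of a chain that can be prolonged by the given
  point. For a strict partial order its fibres are antichains; this is Mirsky's theorem.
\<close>

lemma obtain_height:
  assumes "transp r"
    and chains: "\<And>xs. set xs \<subseteq> S \<Longrightarrow> sorted_wrt r xs \<Longrightarrow> length xs \<le> l"
  obtains h :: "'a \<Rightarrow> nat"
  where "h ` S \<subseteq> {..<l}" "\<And>x y. x \<in> S \<Longrightarrow> y \<in> S \<Longrightarrow> r x y \<Longrightarrow> h x < h y"
proof
  define N where "N x = {length xs |xs. set (xs @ [x]) \<subseteq> S \<and> sorted_wrt r (xs @ [x])}" for x
  have less: "n < l" if "n \<in> N x" for n x
    using that chains unfolding N_def by fastforce
  have fin: "finite (N x)" for x
    using less by (intro finite_subset[OF _ finite_lessThan[of l]]) auto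
  have ne: "0 \<in> N x" if "x \<in> S" for x
    using that unfolding N_def by (auto intro!: exI[of _ "[]"])
  have Max_in: "Max (N x) \<in> N x" if "x \<in> S" for x
    using Max_in[OF fin] ne[OF that] by blast
  show "(\<lambda>x. Max (N x)) ` S \<subseteq> {..<l}"
    using Max_in less by blast
  fix x y
  assume x: "x \<in> S" and y: "y \<in> S" and "r x y"
  obtain xs where xs: "set (xs @ [x]) \<subseteq> S" "sorted_wrt r (xs @ [x])" "Max (N x) = length xs"
    using Max_in[OF x] unfolding N_def by auto
  have "sorted_wrt r ((xs @ [x]) @ [y])"
    using xs \<open>r x y\<close> \<open>transp r\<close> by (auto simp: sorted_wrt_append dest: transpD)
  moreover have "set ((xs @ [x]) @ [y]) \<subseteq> S"
    using xs y by auto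
  ultimately have "length (xs @ [x]) \<in> N y"
    unfolding N_def by blast
  then have "length (xs @ [x]) \<le> Max (N y)"
    by (rule Max_ge[OF fin])
  then show "Max (N x) < Max (N y)"
    using xs by simp
qed

section \<open>Classes of points that pairwise share a coordinate\<close>

text \<open>
  The type of a pair of points that differ in every coordinate of \<open>J\<close> is determined, up to reversal,
  by the set of coordinates that move against the coordinate \<open>j\<close>, a subset \<open>A\<close> of \<open>J - {j}\<close>. The
  class of a point is the family of its heights with respect to these types. Since the height
  increases along a pair of the type of \<open>A\<close>, no such pair lies in one class.
\<close>

lemma obtain_classes:
  fixes S :: "('a \<Rightarrow> 'b::linorder) set"
  assumes "finite J" "j \<in> J"
    and agree: "\<And>x y i. x \<in> S \<Longrightarrow> y \<in> S \<Longrightarrow> i \<notin> J \<Longrightarrow> x i = y i"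
    and chains: "monotone_chains_le l S"
  obtains c :: "('a \<Rightarrow> 'b) \<Rightarrow> 'a set \<Rightarrow> nat" and K
  where "c ` S \<subseteq> K" "finite K" "card K = l ^ (2 ^ (card J - 1))"
    "\<And>x y. x \<in> S \<Longrightarrow> y \<in> S \<Longrightarrow> c x = c y \<Longrightarrow> \<exists>i\<in>J. x i = y i"
proof -
  have "\<exists>h. h ` S \<subseteq> {..<l} \<and> (\<forall>x\<in>S. \<forall>y\<in>S. moves (J - A) A x y \<longrightarrow> h x < h y)"
    if "A \<in> Pow (J - {j})" for A
  proof -
    have "(J - A) \<union> A \<noteq> {}"
      using \<open>j \<in> J\<close> by auto
    then have "\<And>xs. set xs \<subseteq> S \<Longrightarrow> sorted_wrt (moves (J - A) A) xs \<Longrightarrow> length xs \<le> l"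
      using chains unfolding monotone_chains_le_def by blast
    from obtain_height[OF transp_moves this] show ?thesis
      by metis
  qed
  then have "\<forall>A\<in>Pow (J - {j}). \<exists>h. h ` S \<subseteq> {..<l} \<and>
    (\<forall>x\<in>S. \<forall>y\<in>S. moves (J - A) A x y \<longrightarrow> h x < h y)"
    by blast
  from bchoice[OF this] obtain h where
    "\<forall>A\<in>Pow (J - {j}). h A ` S \<subseteq> {..<l} \<and>
      (\<forall>x\<in>S. \<forall>y\<in>S. moves (J - A) A x y \<longrightarrow> h A x < h A y)" ..
  then have h: "h A x \<in> {..<l}" "y \<in> S \<Longrightarrow> moves (J - A) A x y \<Longrightarrow> h A x < h A y"
    if "A \<in> Pow (J - {j})" "x \<in> S" for A x y
    using that by (simp_all add: image_subset_iff)
  define c where "c x = (\<lambda>A\<in>Pow (J - {j}). h A x)" for x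
  have no_rise: False
    if "x \<in> S" "y \<in> S" "c x = c y" "\<forall>i\<in>J. x i \<noteq> y i" "x j < y j" for x y
  proof -
    define A where "A = {i. y i < x i}"
    have "A \<in> Pow (J - {j})"
      using agree[OF that(1,2)] that(5) unfolding A_def by fastforce
    moreover have "{i. x i < y i} = J - A"
      using agree[OF that(1,2)] that(4) unfolding A_def by (fastforce simp: neq_iff)
    then have "moves (J - A) A x y"
      unfolding moves_def A_def by blast
    ultimately have "h A x < h A y" and "h A x = h A y"
      using h(2) that(1,2) \<open>c x = c y\<close> unfolding c_def by (auto dest!: fun_cong[of _ _ A])
    then show False
      by simp
  qed
  show thesis
  proof
    show "c ` S \<subseteq> Pow (J - {j}) \<rightarrow>\<^sub>E {..<l}"
      using h(1) unfolding c_def by (intro image_subsetI restrict_PiE_iff[THEN iffD2] ballI)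
    show "finite (Pow (J - {j}) \<rightarrow>\<^sub>E {..<l})"
      using \<open>finite J\<close> by (intro finite_PiE) auto
    show "card (Pow (J - {j}) \<rightarrow>\<^sub>E {..<l}) = l ^ (2 ^ (card J - 1))"
      using assms(1,2) by (simp add: card_PiE card_Pow)
    show "\<exists>i\<in>J. x i = y i" if "x \<in> S" "y \<in> S" "c x = c y" for x y
    proof (rule ccontr)
      assume "\<not> (\<exists>i\<in>J. x i = y i)"
      then show False
        using no_rise[of x y] no_rise[of y x] that \<open>j \<in> J\<close> by (metis linorder_neqE)
    qed
  qed
qed

lemma mult_Suc_le_power_3: "(m + 2) * (m + 1) \<le> (3::nat) ^ (2 ^ m)"
proof (induction m)
  case (Suc m)
  show ?case
  proof (cases "m = 0")
    case False
    then obtain k where k: "m = Suc k"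
      using not0_implies_Suc by blast
    \<comment> \<open>The right-hand side is squared in each step. At \<open>m = 0\<close> the square of the left-hand side is
      still too small, so that the values \<open>6 \<le> 9\<close> are compared there.\<close>
    have "(Suc m + 2) * (Suc m + 1) \<le> ((m + 2) * (m + 1)) ^ 2"
      by (simp add: k power2_eq_square algebra_simps)
    also have "\<dots> \<le> (3 ^ (2 ^ m)) ^ 2"
      using Suc.IH by (rule power_mono) simp
    also have "\<dots> = 3 ^ (2 ^ Suc m)"
      by (simp flip: power_mult add: mult.commute)
    finally show ?thesis .
  qed simp
qed simp

text \<open>
  A class without a common coordinate is covered by \<open>m * (m - 1)\<close> sets that vary in \<open>m - 2\<close>
  coordinates; this lets it satisfy the bound for \<open>m - 1\<close> coordinates.
\<close>

lemma pairs_times_power_le: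
  assumes "2 \<le> m" "3 \<le> l"
  shows "m * (m - 1) * l ^ (2 ^ (m - 2) - 1) \<le> l ^ (2 ^ (m - 1) - 1)"
proof -
  obtain k where m: "m = k + 2"
    using \<open>2 \<le> m\<close> by (metis le_add_diff_inverse2)
  have "m * (m - 1) \<le> 3 ^ (2 ^ k)"
    using mult_Suc_le_power_3[of k] by (simp add: m)
  also have "\<dots> \<le> l ^ (2 ^ k)"
    using \<open>3 \<le> l\<close> by (rule power_mono) simp
  finally have "m * (m - 1) * l ^ (2 ^ k - 1) \<le> l ^ (2 ^ k) * l ^ (2 ^ k - 1)"
    by (rule mult_right_mono) simp
  also have "\<dots> = l ^ (2 ^ (k + 1) - 1)"
    by (simp flip: power_add add: mult_2)
  finally show ?thesis
    by (simp add: m)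
qed

lemma intersecting_cover:
  assumes "x \<in> T"
    and share: "\<And>z w. z \<in> T \<Longrightarrow> w \<in> T \<Longrightarrow> \<exists>i\<in>J. z i = w i"
    and y: "\<And>i. i \<in> J \<Longrightarrow> y i \<in> T \<and> y i i \<noteq> x i"
  shows "T \<subseteq> (\<Union>(i, j)\<in>Sigma J (\<lambda>i. J - {i}). {z \<in> T. z i = x i \<and> z j = y i j})"
proof
  fix z
  assume "z \<in> T"
  then obtain i where i: "i \<in> J" "z i = x i"
    using share \<open>x \<in> T\<close> by blast
  then obtain j where j: "j \<in> J" "z j = y i j"
    using share \<open>z \<in> T\<close> y by blast
  then have "j \<noteq> i"
    using i y by metis
  with i j \<open>z \<in> T\<close> show "z \<in> (\<Union>(i, j)\<in>Sigma J (\<lambda>i. J - {i}). {z \<in> T. z i = x i \<and> z j = y i j})"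
    by blast
qed

section \<open>The number of points without long chains\<close>

text \<open>
  The induction keeps the space of points and shrinks the set \<open>J\<close> of coordinates in which points
  of \<open>S\<close> may differ; fixing a coordinate then needs no projection.
\<close>

lemma card_le_if_monotone_chains_le_finite:
  fixes S :: "('a \<Rightarrow> 'b::linorder) set"
  assumes "3 \<le> l" "finite J" "finite S"
    and "\<And>x y i. x \<in> S \<Longrightarrow> y \<in> S \<Longrightarrow> i \<notin> J \<Longrightarrow> x i = y i"
    and "monotone_chains_le l S"
  shows "card S \<le> l ^ (2 ^ card J - 1)"
  using assms(2-)
proof (induction "card J" arbitrary: J S rule: less_induct)
  case less
  note agree = less.prems(3)
  show ?case
  proof (cases "J = {}")
    case True
    then have "x = y" if "x \<in> S" "y \<in> S" for x y
      using agree[OF that] by auto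
    then show ?thesis
      using True \<open>finite S\<close> by (simp add: card_le_Suc0_iff_eq)
  next
    case False
    then obtain j where "j \<in> J"
      by blast
    let ?m = "card J"
    let ?b = "l ^ (2 ^ (?m - 1) - 1)"
    have "0 < ?m"
      using False \<open>finite J\<close> by (simp add: card_gt_0_iff)
    have IH: "card T \<le> l ^ (2 ^ card I - 1)"
      if "T \<subseteq> S" "I \<subset> J" "\<And>x y i. x \<in> T \<Longrightarrow> y \<in> T \<Longrightarrow> i \<in> J - I \<Longrightarrow> x i = y i" for T I
    proof (rule less.hyps)
      show "card I < card J"
        using psubset_card_mono[OF \<open>finite J\<close> that(2)] .
      show "finite I" "finite T"
        using that(1,2) \<open>finite J\<close> \<open>finite S\<close> by (auto intro: finite_subset)
      show "x i = y i" if "x \<in> T" "y \<in> T" "i \<notin> I" for x y i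
        using that \<open>T \<subseteq> S\<close> agree[of x y i] \<open>\<And>x y i. x \<in> T \<Longrightarrow> y \<in> T \<Longrightarrow> i \<in> J - I \<Longrightarrow> x i = y i\<close>
        by blast
      show "monotone_chains_le l T"
        using monotone_chains_le_subset less.prems(4) that(1) by blast
    qed
    have class_le: "card T \<le> ?b"
      if "T \<subseteq> S" and share: "\<And>x y. x \<in> T \<Longrightarrow> y \<in> T \<Longrightarrow> \<exists>i\<in>J. x i = y i" for T
    proof (cases "\<exists>j\<in>J. \<forall>x\<in>T. \<forall>y\<in>T. x j = y j")
      case True
      then obtain k where k: "k \<in> J" "\<forall>x\<in>T. \<forall>y\<in>T. x k = y k"
        by blast
      have "card T \<le> l ^ (2 ^ card (J - {k}) - 1)"
        using k by (intro IH[OF \<open>T \<subseteq> S\<close>]) auto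
      then show ?thesis
        using k by simp
    next
      case no_common: False
      show ?thesis
      proof (cases "T = {}")
        case False
        then obtain x where x: "x \<in> T"
          by blast
        have "\<exists>y\<in>T. y i \<noteq> x i" if "i \<in> J" for i
          using no_common that by metis
        then obtain y where y: "\<And>i. i \<in> J \<Longrightarrow> y i \<in> T \<and> y i i \<noteq> x i"
          by metis
        let ?P = "Sigma J (\<lambda>i. J - {i})"
        let ?F = "\<lambda>(i, j). {z \<in> T. z i = x i \<and> z j = y i j}"
        let ?b2 = "l ^ (2 ^ (?m - 2) - 1)"
        have card_P: "card ?P = ?m * (?m - 1)"
          using \<open>finite J\<close> by (simp add: card_SigmaI)
        have T: "T \<subseteq> \<Union> (?F ` ?P)"
          using intersecting_cover[OF x share y] by blast
        have F: "card (?F p) \<le> ?b2" if p_in: "p \<in> ?P" for p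
        proof -
          obtain i k where p: "p = (i, k)" "i \<in> J" "k \<in> J" "k \<noteq> i"
            using p_in by auto
          have "card (?F p) \<le> l ^ (2 ^ card (J - {i, k}) - 1)"
            using p \<open>T \<subseteq> S\<close> by (intro IH) auto
          moreover have "card (J - {i, k}) = ?m - 2"
            using p by (subst card_Diff_subset) auto
          ultimately show ?thesis
            by simp
        qed
        have finP: "finite ?P"
          using \<open>finite J\<close> by simp
        have finF: "finite (\<Union> (?F ` ?P))"
          using \<open>T \<subseteq> S\<close> \<open>finite S\<close> by (auto intro: finite_subset)
        have "card T \<le> card (\<Union> (?F ` ?P))"
          using T finF by (rule card_mono[rotated])
        also have "\<dots> \<le> (\<Sum>p\<in>?P. card (?F p))"
          by (rule card_UN_le[OF finP])
        also have "\<dots> \<le> (\<Sum>p\<in>?P. ?b2)"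
          using F by (rule sum_mono)
        also have "\<dots> = ?m * (?m - 1) * ?b2"
          by (simp only: sum_constant card_P of_nat_id)
        also have "\<dots> \<le> ?b"
          using pairs_times_power_le[OF _ \<open>3 \<le> l\<close>, of ?m] \<open>0 < ?m\<close> by (cases "?m = 1") auto
        finally show ?thesis .
      qed simp
    qed
    obtain c :: "('a \<Rightarrow> 'b) \<Rightarrow> 'a set \<Rightarrow> nat" and K
      where K: "c ` S \<subseteq> K" "finite K" "card K = l ^ (2 ^ (?m - 1))"
        and c: "\<And>x y. x \<in> S \<Longrightarrow> y \<in> S \<Longrightarrow> c x = c y \<Longrightarrow> \<exists>i\<in>J. x i = y i"
    proof (rule obtain_classes[OF \<open>finite J\<close> \<open>j \<in> J\<close> _ less.prems(4)])
      show "x i = y i" if "x \<in> S" "y \<in> S" "i \<notin> J" for x y i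
        using that by (rule agree)
    qed (rule that)
    have "S = (\<Union>k\<in>K. {x \<in> S. c x = k})"
      using K(1) by blast
    then have "card S \<le> (\<Sum>k\<in>K. card {x \<in> S. c x = k})"
      using card_UN_le[OF K(2), of "\<lambda>k. {x \<in> S. c x = k}"] by simp
    also have "\<dots> \<le> (\<Sum>k\<in>K. ?b)"
      using c by (intro sum_mono class_le) auto
    also have "\<dots> = l ^ (2 ^ (?m - 1) + (2 ^ (?m - 1) - 1))"
      by (simp only: sum_constant K(3) power_add of_nat_id)
    also have "2 ^ (?m - 1) + (2 ^ (?m - 1) - 1) = 2 ^ ?m - (1::nat)"
      using \<open>0 < ?m\<close> by (cases ?m) auto
    finally show ?thesis .
  qed
qed

theorem card_le_if_monotone_chains_le:
  fixes S :: "('a \<Rightarrow> 'b::linorder) set"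
  assumes "3 \<le> l" "finite J"
    and agree: "\<And>x y i. x \<in> S \<Longrightarrow> y \<in> S \<Longrightarrow> i \<notin> J \<Longrightarrow> x i = y i"
    and chains: "monotone_chains_le l S"
  shows "finite S \<and> card S \<le> l ^ (2 ^ card J - 1)"
proof -
  have "card T \<le> l ^ (2 ^ card J - 1)" if "finite T" "T \<subseteq> S" for T
    using card_le_if_monotone_chains_le_finite[OF assms(1,2) that(1)] agree
      monotone_chains_le_subset[OF chains that(2)] that(2) by blast
  then show ?thesis
    by (metis finite_if_finite_subsets_card_bdd)
qed

section \<open>Stable sets\<close>

lemma stable_set_imp_monotone_chains_le_3:
  fixes \<pi> :: "'n::finite set \<Rightarrow> real ^ 'n \<Rightarrow> real"
  assumes "power_function \<pi>" "stable_set \<pi> S"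
  shows "monotone_chains_le 3 (($) ` S)"
  unfolding monotone_chains_le_def
proof (intro allI impI, elim conjE, rule ccontr)
  fix U D :: "'n set" and xs :: "('n \<Rightarrow> real) list"
  assume "U \<union> D \<noteq> {}" "set xs \<subseteq> ($) ` S" "sorted_wrt (moves U D) xs" "\<not> length xs \<le> 3"
  have "xs \<in> map ($) ` lists S"
    using \<open>set xs \<subseteq> ($) ` S\<close> by (subst lists_image[symmetric]) (auto simp: lists_eq_set)
  then obtain ys where ys: "xs = map ($) ys" "set ys \<subseteq> S"
    by (auto simp: lists_eq_set)
  have "Suc (Suc (Suc (Suc 0))) \<le> length ys"
    using \<open>\<not> length xs \<le> 3\<close> by (simp add: ys(1))
  then obtain a b c d zs where abcd: "ys = a # b # c # d # zs"
    by (auto simp: Suc_le_length_iff)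
  have S: "a \<in> S" "b \<in> S" "c \<in> S" "d \<in> S"
    using ys(2) by (auto simp: abcd)
  have ab: "{i. a $ i < b $ i} = U" "{i. b $ i < a $ i} = D"
    and bc: "{i. b $ i < c $ i} = U" "{i. c $ i < b $ i} = D"
    and cd: "{i. c $ i < d $ i} = U" "{i. d $ i < c $ i} = D"
    using \<open>sorted_wrt (moves U D) xs\<close> by (auto simp: ys(1) abcd moves_def)
  have undominated: "\<not> dominates \<pi> y x" if "x \<in> S" "y \<in> S" for x y
    using \<open>stable_set \<pi> S\<close> that unfolding stable_set_def by (cases "y = x") (auto simp: dominates_def)
  have alloc: "b \<in> allocations" "c \<in> allocations"
    using \<open>stable_set \<pi> S\<close> S unfolding stable_set_def by auto
  have "\<pi> D b \<le> \<pi> U b"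
    using undominated[OF S(2,1)] by (simp add: dominates_def ab)
  moreover have "\<pi> U c \<le> \<pi> D c"
    using undominated[OF S(3,4)] by (simp add: dominates_def cd)
  moreover have U: "\<forall>i\<in>U. b $ i < c $ i" and D: "\<forall>i\<in>D. c $ i < b $ i"
    using bc by auto
  then have "\<pi> U b \<le> \<pi> U c" "\<pi> D c \<le> \<pi> D b"
    using \<open>power_function \<pi>\<close> alloc unfolding power_function_def by (auto simp: less_imp_le)
  moreover have "\<pi> U b < \<pi> U c \<or> \<pi> D c < \<pi> D b"
    using \<open>power_function \<pi>\<close> alloc U D \<open>U \<union> D \<noteq> {}\<close> unfolding power_function_def
    by (metis Un_empty)
  ultimately show False
    by linarith
qed

theorem theorem20:
  fixes \<pi> :: "'n::finite set \<Rightarrow> real ^ 'n \<Rightarrow> real"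
    and S :: "(real ^ 'n) set"
  assumes "power_function \<pi>"
    and "stable_set \<pi> S"
  shows "finite S \<and> card S \<le> 3 ^ (2 ^ CARD('n) - 1)"
proof -
  have inj: "inj_on ($) S"
    by (simp add: inj_on_def vec_nth_inject)
  have "finite (($) ` S) \<and> card (($) ` S) \<le> 3 ^ (2 ^ CARD('n) - 1)"
    using stable_set_imp_monotone_chains_le_3[OF assms]
    by (intro card_le_if_monotone_chains_le) auto
  then show ?thesis
    using inj by (simp add: finite_image_iff card_image)
qed

end
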